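(* For every $\theta_0\in\mathbb{R}_+$, the estimators $\widehat\theta_N$ and $\widehat\theta_N^{\mathrm{MLE}}$ are strongly consistent: $$\lim_{N\to\infty}\widehat\theta_N=\theta_0\quad\text{and}\quad\lim_{N\to\infty}\widehat\theta_N^{\mathrm{MLE}}=\theta_0,\qquad\mathbb{P}\text{-a.s.}$$ In addition, for every $N\in\mathbb{N}$ and $\theta_0\in\mathbb{R}_+$, $\sqrt{I_N}\big(\widehat\theta_N-\theta_0\big)=\xi_N$, and $\xi_N$ has distribution $\mathcal{N}(0,1)$ under $\mathbb{P}$.
   Context: $\mathbb{R}_+:=(0,\infty)$. $(\Omega,\mathscr{F},\{\mathscr{F}_t\},\mathbb{P})$ is a stochastic basis satisfying the usual assumptions, with independent standard Brownian motions $\{w_k\}_{k\in\mathbb{N}}$. $\{\mu_k\}\subset(0,\infty)$ with $\mu_k\to\infty$ (the eigenvalues of a positive definite self-adjoint operator $A$ on a separable Hilbert space), $\{q_k\}\subset(0,\infty)$, $\sigma>0$ and $T>0$ are fixed and known. For $\theta\in\mathbb{R}_+$, $u_k^\theta$ is the $k$-th Fourier mode of the solution of $du+\theta Au\,dt=\sigma\sum_ku_kh_kq_k\,dw_k$ ($h_k$ the eigenvectors of $A$), i.e. $du_k^\theta=-\theta\mu_ku_k^\theta\,dt+\sigma q_ku_k^\theta\,dw_k$, so $u_k^\theta(t)=u_k(0)\exp\big(-(\theta\mu_k+\tfrac12\sigma^2q_k^2)t+\sigma q_kw_k(t)\big)$, $t\in[0,T]$, with $\mathscr{F}_0$-measurable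 $u_k(0)\ne0$ not depending on $\theta$. Standing assumption: the well-posedness condition of the equation holds for at least one parameter value, i.e. there exist $\bar\theta>0$, $N_0\in\mathbb{N}$, $c>0$ with $2\bar\theta-\sigma^2q_k^2/\mu_k\ge c$ for all $k\ge N_0$. $\theta_0\in\mathbb{R}_+$ is the true parameter value and the observation is $U_N=(u_1,\dots,u_N)$ on $[0,T]$ with $u_k:=u_k^{\theta_0}$. The Fisher information is $I_N:=\frac{T}{\sigma^2}\sum_{k=1}^N\mu_k^2q_k^{-2}$. Put $$\widehat\theta_N:=-\frac{\sum_{k=1}^N\mu_kq_k^{-2}\int_0^T\frac{du_k(t)}{u_k(t)}}{T\sum_{k=1}^N\mu_k^2q_k^{-2}},\qquad\widehat\theta_N^{\mathrm{MLE}}:=\mathbf{1}_{\{\widehat\theta_N\in\mathbb{R}_+\}}\widehat\theta_N,\qquad\xi_N:=-\frac{1}{\sigma\sqrt{I_N}}\sum_{k=1}^N\mu_kq_k^{-1}w_k(T).$$ *)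

theory Defs
  imports "HOL-Probability.Probability"
begin

text \<open>Filtrations and processes are indexed by \<^typ>\<open>real\<close>; only times \<open>t \<ge> 0\<close> are meaningful,
  and nothing is assumed about negative times.\<close>

locale stochastic_basis = prob_space M + complete_measure M
  for M :: "'a measure" +
  fixes F :: "real \<Rightarrow> 'a measure"
  assumes subalgebra_F: "0 \<le> t \<Longrightarrow> subalgebra M (F t)"
    and mono_F: "0 \<le> s \<Longrightarrow> s \<le> t \<Longrightarrow> sets (F s) \<subseteq> sets (F t)"
    and right_continuous_F: "0 \<le> t \<Longrightarrow> sets (F t) = (\<Inter>s\<in>{t<..}. sets (F s))"
    and null_sets_F: "null_sets M \<subseteq> sets (F 0)"

definition (in stochastic_basis) brownian_motion :: "(real \<Rightarrow> 'a \<Rightarrow> real) \<Rightarrow> bool" where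
  "brownian_motion w \<longleftrightarrow>
     (\<forall>t\<ge>0. w t \<in> borel_measurable (F t)) \<and>
     (AE \<omega> in M. w 0 \<omega> = 0) \<and>
     (AE \<omega> in M. continuous_on {0..} (\<lambda>t. w t \<omega>)) \<and>
     (\<forall>s t. 0 \<le> s \<longrightarrow> s < t \<longrightarrow>
        distributed M lborel (\<lambda>\<omega>. w t \<omega> - w s \<omega>) (normal_density 0 (sqrt (t - s))) \<and>
        indep_set (sets (F s))
          (sets (vimage_algebra (space M) (\<lambda>\<omega>. w t \<omega> - w s \<omega>) borel)))"

text \<open>Independence of the family means independence of the whole processes, viewed as random
  elements of the product space over all times \<open>t \<ge> 0\<close>.  Families are indexed by \<open>k \<ge> 1\<close>.\<close>

definition (in stochastic_basis) independent_brownian_motions ::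
    "(nat \<Rightarrow> real \<Rightarrow> 'a \<Rightarrow> real) \<Rightarrow> bool" where
  "independent_brownian_motions w \<longleftrightarrow>
     (\<forall>k\<ge>1. brownian_motion (w k)) \<and>
     indep_vars (\<lambda>_. Pi\<^sub>M {0..} (\<lambda>_. borel)) (\<lambda>k \<omega>. \<lambda>t\<in>{0..}. w k t \<omega>) {1..}"

definition continuous_adapted ::
    "'a measure \<Rightarrow> (real \<Rightarrow> 'a measure) \<Rightarrow> real \<Rightarrow> (real \<Rightarrow> 'a \<Rightarrow> real) \<Rightarrow> bool" where
  "continuous_adapted M F T X \<longleftrightarrow>
     (\<forall>t\<in>{0..T}. X t \<in> borel_measurable (F t)) \<and>
     (AE \<omega> in M. continuous_on {0..T} (\<lambda>t. X t \<omega>))"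

text \<open>The Ito integral over \<open>[0, T]\<close> of a continuous adapted process \<open>X\<close> against a continuous
  adapted process \<open>Y\<close> (in applications, a semimartingale): the limit in probability of the
  left-endpoint sums as the mesh of the deterministic partition
  \<open>0 = p 0 < p 1 < \<dots> < p m = T\<close> tends to 0.  The limit is unique up to null sets only, so
  \<open>ito_integral\<close> selects a version.\<close>

definition left_sum ::
    "(real \<Rightarrow> 'a \<Rightarrow> real) \<Rightarrow> (real \<Rightarrow> 'a \<Rightarrow> real) \<Rightarrow> (nat \<Rightarrow> real) \<Rightarrow> nat \<Rightarrow> 'a \<Rightarrow> real" where
  "left_sum X Y p m \<omega> = (\<Sum>i<m. X (p i) \<omega> * (Y (p (Suc i)) \<omega> - Y (p i) \<omega>))"

definition has_ito_integral ::
    "'a measure \<Rightarrow> (real \<Rightarrow> 'a measure) \<Rightarrow> real \<Rightarrow> (real \<Rightarrow> 'a \<Rightarrow> real) \<Rightarrow> (real \<Rightarrow> 'a \<Rightarrow> real) \<Rightarrow>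
     ('a \<Rightarrow> real) \<Rightarrow> bool" where
  "has_ito_integral M F T X Y J \<longleftrightarrow>
     continuous_adapted M F T X \<and> continuous_adapted M F T Y \<and> J \<in> borel_measurable M \<and>
     (\<forall>\<epsilon>>0. \<forall>\<eta>>0. \<exists>\<delta>>0. \<forall>p m.
        p 0 = 0 \<and> p m = T \<and> (\<forall>i<m. 0 < p (Suc i) - p i \<and> p (Suc i) - p i < \<delta>) \<longrightarrow>
        measure M {\<omega> \<in> space M. \<bar>left_sum X Y p m \<omega> - J \<omega>\<bar> > \<epsilon>} < \<eta>)"

definition ito_integral ::
    "'a measure \<Rightarrow> (real \<Rightarrow> 'a measure) \<Rightarrow> real \<Rightarrow> (real \<Rightarrow> 'a \<Rightarrow> real) \<Rightarrow> (real \<Rightarrow> 'a \<Rightarrow> real) \<Rightarrow>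
     'a \<Rightarrow> real" where
  "ito_integral M F T X Y = (SOME J. has_ito_integral M F T X Y J)"

text \<open>The solution of \<open>du\<^sub>k = - \<theta> \<mu>\<^sub>k u\<^sub>k dt + \<sigma> q\<^sub>k u\<^sub>k dw\<^sub>k\<close> with initial value \<open>u0 k\<close>.\<close>

definition fourier_mode ::
    "(nat \<Rightarrow> real) \<Rightarrow> (nat \<Rightarrow> real) \<Rightarrow> real \<Rightarrow> (nat \<Rightarrow> 'a \<Rightarrow> real) \<Rightarrow> (nat \<Rightarrow> real \<Rightarrow> 'a \<Rightarrow> real) \<Rightarrow>
     real \<Rightarrow> nat \<Rightarrow> real \<Rightarrow> 'a \<Rightarrow> real" where
  "fourier_mode \<mu> q \<sigma> u0 w \<theta> k t \<omega> =
     u0 k \<omega> * exp (- (\<theta> * \<mu> k + \<sigma>\<^sup>2 * (q k)\<^sup>2 / 2) * t + \<sigma> * q k * w k t \<omega>)"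

definition well_posed :: "(nat \<Rightarrow> real) \<Rightarrow> (nat \<Rightarrow> real) \<Rightarrow> real \<Rightarrow> real \<Rightarrow> bool" where
  "well_posed \<mu> q \<sigma> \<theta> \<longleftrightarrow>
     (\<exists>N0\<ge>1. \<exists>c>0. \<forall>k\<ge>N0. 2 * \<theta> - \<sigma>\<^sup>2 * (q k)\<^sup>2 / \<mu> k \<ge> c)"

definition fisher_information ::
    "(nat \<Rightarrow> real) \<Rightarrow> (nat \<Rightarrow> real) \<Rightarrow> real \<Rightarrow> real \<Rightarrow> nat \<Rightarrow> real" where
  "fisher_information \<mu> q \<sigma> T N = T / \<sigma>\<^sup>2 * (\<Sum>k=1..N. (\<mu> k)\<^sup>2 / (q k)\<^sup>2)"

text \<open>The estimators are functions of the observed modes \<open>u 1, \<dots>, u N\<close> on \<open>[0, T]\<close> and of the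
  known quantities only.\<close>

definition theta_hat ::
    "'a measure \<Rightarrow> (real \<Rightarrow> 'a measure) \<Rightarrow> real \<Rightarrow> (nat \<Rightarrow> real) \<Rightarrow> (nat \<Rightarrow> real) \<Rightarrow>
     (nat \<Rightarrow> real \<Rightarrow> 'a \<Rightarrow> real) \<Rightarrow> nat \<Rightarrow> 'a \<Rightarrow> real" where
  "theta_hat M F T \<mu> q u N \<omega> =
     - (\<Sum>k=1..N. \<mu> k / (q k)\<^sup>2 * ito_integral M F T (\<lambda>t \<omega>. 1 / u k t \<omega>) (u k) \<omega>)
       / (T * (\<Sum>k=1..N. (\<mu> k)\<^sup>2 / (q k)\<^sup>2))"

definition theta_hat_MLE ::
    "'a measure \<Rightarrow> (real \<Rightarrow> 'a measure) \<Rightarrow> real \<Rightarrow> (nat \<Rightarrow> real) \<Rightarrow> (nat \<Rightarrow> real) \<Rightarrow>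
     (nat \<Rightarrow> real \<Rightarrow> 'a \<Rightarrow> real) \<Rightarrow> nat \<Rightarrow> 'a \<Rightarrow> real" where
  "theta_hat_MLE M F T \<mu> q u N \<omega> =
     indicator {0<..} (theta_hat M F T \<mu> q u N \<omega>) * theta_hat M F T \<mu> q u N \<omega>"

definition xi ::
    "(nat \<Rightarrow> real) \<Rightarrow> (nat \<Rightarrow> real) \<Rightarrow> real \<Rightarrow> real \<Rightarrow> (nat \<Rightarrow> real \<Rightarrow> 'a \<Rightarrow> real) \<Rightarrow> nat \<Rightarrow>
     'a \<Rightarrow> real" where
  "xi \<mu> q \<sigma> T w N \<omega> =
     - (1 / (\<sigma> * sqrt (fisher_information \<mu> q \<sigma> T N))) * (\<Sum>k=1..N. \<mu> k / q k * w k T \<omega>)"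

end

theory Submission
  imports Defs "HOL-Real_Asymp.Real_Asymp"
begin

text \<open>
  The modes are geometric Brownian motions, so the integral of \<open>du\<^sub>k / u\<^sub>k\<close> over \<open>[0, T]\<close>
  equals \<open>- \<theta>\<^sub>0 \<mu>\<^sub>k T + \<sigma> q\<^sub>k w\<^sub>k(T)\<close> almost surely.  Substituting this into the estimator
  leaves the true parameter plus a linear combination of the independent Gaussians \<open>w\<^sub>k(T)\<close>,
  whose weights are exactly those that make the normalised error equal to \<open>\<xi>\<^sub>N\<close>
  (\<open>theta_hat_error_eq_xi\<close>) and give \<open>\<xi>\<^sub>N\<close> unit variance (\<open>xi_std_normal\<close>).

  The stochastic integral is evaluated directly as a limit of left-endpoint sums.
  Almost surely a left-endpoint sum of \<open>du / u\<close> is a sum of terms \<open>exp (\<Delta>X) - 1\<close> over the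
  increments of \<open>X = ln \<bar>u\<bar>\<close>.  Subtracting the claimed value increment by increment leaves one error
  term per partition interval.  Gaussian exponential moments show that the mean and the second
  moment of the error over an interval of length \<open>D\<close> are both \<open>O(D\<^sup>2)\<close>: the compensator in the
  exponent cancels the first order of the mean, and the linear term \<open>b \<Delta>w\<close> cancels that of the
  second moment.  Each error is independent of the preceding ones, so covariances contribute only
  products of means.  The total error thus has second moment at most of the order of the mesh,
  and Chebyshev's inequality gives convergence in probability
  (\<open>has_ito_integral_logarithmic_differential\<close>).  Limits in probability are unique up to null sets
  (\<open>has_ito_integral_unique_AE\<close>), so the version picked by \<open>ito_integral\<close> is this one.

  For consistency, the estimation error is
  \<open>\<xi>\<^sub>N / sqrt I\<^sub>N\<close> with fourth moment \<open>3 / I\<^sub>N\<^sup>2\<close>.  Well-posedness for some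
  parameter value bounds \<open>q\<^sub>k\<^sup>2\<close> by a multiple of \<open>\<mu>\<^sub>k\<close>, so \<open>\<mu>\<^sub>k\<^sup>2 / q\<^sub>k\<^sup>2\<close> is eventually bounded
  away from 0 and \<open>I\<^sub>N\<close> grows at least linearly.  The fourth moments are then summable, which
  forces almost sure convergence to 0 (\<open>std_normal_div_sqrt_tendsto_zero\<close>).
\<close>

section \<open>Second moments of sums of increments\<close>

text \<open>Independence of each term from the partial sum before it makes the mixed terms of the square
  products of expectations, which recombine to the square of the total mean.
  The bound overshoots the exact value by the sum of the squared means.\<close>

lemma (in prob_space) second_moment_sum_independent_of_past:
  fixes Z :: "nat \<Rightarrow> 'a \<Rightarrow> real"
  assumes [measurable]: "\<And>i. i < n \<Longrightarrow> Z i \<in> borel_measurable M"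
    and sq: "\<And>i. i < n \<Longrightarrow> integrable M (\<lambda>\<omega>. (Z i \<omega>)\<^sup>2)"
    and ind: "\<And>i. i < n \<Longrightarrow> indep_var borel (\<lambda>\<omega>. \<Sum>j<i. Z j \<omega>) borel (Z i)"
  shows "integrable M (\<lambda>\<omega>. (\<Sum>i<n. Z i \<omega>)\<^sup>2)" (is ?int)
    and "expectation (\<lambda>\<omega>. (\<Sum>i<n. Z i \<omega>)\<^sup>2)
           \<le> (\<Sum>i<n. expectation (Z i))\<^sup>2 + (\<Sum>i<n. expectation (\<lambda>\<omega>. (Z i \<omega>)\<^sup>2))" (is ?bound)
proof -
  let ?V = "\<lambda>n \<omega>. \<Sum>i<n. Z i \<omega>"
  have int: "integrable M (Z i)" if "i < n" for i
    using square_integrable_imp_integrable[OF assms(1) sq] that by auto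
  have "m \<le> n \<Longrightarrow> integrable M (\<lambda>\<omega>. (?V m \<omega>)\<^sup>2) \<and>
      expectation (\<lambda>\<omega>. (?V m \<omega>)\<^sup>2)
        \<le> (\<Sum>i<m. expectation (Z i))\<^sup>2 + (\<Sum>i<m. expectation (\<lambda>\<omega>. (Z i \<omega>)\<^sup>2))" for m
  proof (induction m)
    case 0
    then show ?case by simp
  next
    case (Suc m)
    then have m: "m < n"
      and intV2: "integrable M (\<lambda>\<omega>. (?V m \<omega>)\<^sup>2)"
      and IH: "expectation (\<lambda>\<omega>. (?V m \<omega>)\<^sup>2)
        \<le> (\<Sum>i<m. expectation (Z i))\<^sup>2 + (\<Sum>i<m. expectation (\<lambda>\<omega>. (Z i \<omega>)\<^sup>2))"
      by auto
    have intV: "integrable M (?V m)"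
      using m by (intro Bochner_Integration.integrable_sum int) auto
    have EV: "expectation (?V m) = (\<Sum>i<m. expectation (Z i))"
      using m by (intro Bochner_Integration.integral_sum int) auto
    have intVZ: "integrable M (\<lambda>\<omega>. ?V m \<omega> * Z m \<omega>)"
      by (rule indep_var_integrable[OF ind[OF m] intV int[OF m]])
    have EVZ: "expectation (\<lambda>\<omega>. ?V m \<omega> * Z m \<omega>) = (\<Sum>i<m. expectation (Z i)) * expectation (Z m)"
      unfolding EV[symmetric]
      by (rule indep_var_lebesgue_integral[OF ind[OF m] intV int[OF m]])
    have eq: "(\<lambda>\<omega>. (?V (Suc m) \<omega>)\<^sup>2)
        = (\<lambda>\<omega>. (?V m \<omega>)\<^sup>2 + 2 * (?V m \<omega> * Z m \<omega>) + (Z m \<omega>)\<^sup>2)"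
      by (simp add: fun_eq_iff power2_eq_square algebra_simps)
    have "expectation (\<lambda>\<omega>. (?V (Suc m) \<omega>)\<^sup>2)
        = expectation (\<lambda>\<omega>. (?V m \<omega>)\<^sup>2) + 2 * ((\<Sum>i<m. expectation (Z i)) * expectation (Z m))
          + expectation (\<lambda>\<omega>. (Z m \<omega>)\<^sup>2)"
      unfolding eq using intV2 intVZ sq[OF m] by (simp add: EVZ)
    also have "\<dots> \<le> (\<Sum>i<Suc m. expectation (Z i))\<^sup>2
        + (\<Sum>i<Suc m. expectation (\<lambda>\<omega>. (Z i \<omega>)\<^sup>2))"
      unfolding sum.lessThan_Suc power2_sum
      using IH zero_le_power2[of "expectation (Z m)"] by linarith
    finally show ?case
      unfolding eq using intV2 intVZ sq[OF m] by auto
  qed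
  then show ?int ?bound by auto
qed

section \<open>The error over one partition interval\<close>

text \<open>Completing the square: an exponential weight shifts the mean of a Gaussian, which reduces
  exponential moments to ordinary ones.\<close>

lemma normal_density_exponential_tilt:
  assumes "D > 0"
  shows "normal_density 0 (sqrt D) x * exp (a * x)
    = exp (a\<^sup>2 * D / 2) * normal_density (a * D) (sqrt D) x"
proof -
  have "- x\<^sup>2 / (2 * D) + a * x = a\<^sup>2 * D / 2 + - (x - a * D)\<^sup>2 / (2 * D)"
    using assms by (simp add: power2_eq_square field_simps)
  then show ?thesis
    using assms by (simp add: normal_density_def mult_exp_exp)
qed

lemma (in prob_space) normal_exponential_moment:
  assumes Y: "distributed M lborel Y (normal_density 0 (sqrt D))" and D: "D > 0"
  shows "integrable M (\<lambda>\<omega>. exp (a * Y \<omega>))"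
    and "expectation (\<lambda>\<omega>. exp (a * Y \<omega>)) = exp (a\<^sup>2 * D / 2)"
    and "integrable M (\<lambda>\<omega>. Y \<omega> * exp (a * Y \<omega>))"
    and "expectation (\<lambda>\<omega>. Y \<omega> * exp (a * Y \<omega>)) = a * D * exp (a\<^sup>2 * D / 2)"
proof -
  have tilt: "normal_density 0 (sqrt D) x * exp (a * x)
      = exp (a\<^sup>2 * D / 2) * normal_density (a * D) (sqrt D) x" for x
    by (rule normal_density_exponential_tilt[OF D])
  have tilt': "normal_density 0 (sqrt D) x * (x * exp (a * x))
      = exp (a\<^sup>2 * D / 2) * (normal_density (a * D) (sqrt D) x * x)" for x
    using tilt[of x] by (simp add: algebra_simps)
  show "integrable M (\<lambda>\<omega>. exp (a * Y \<omega>))"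
    using D by (subst distributed_integrable[OF Y, of "\<lambda>y. exp (a * y)", symmetric]) (auto simp: tilt)
  show "expectation (\<lambda>\<omega>. exp (a * Y \<omega>)) = exp (a\<^sup>2 * D / 2)"
    using D by (subst distributed_integral[OF Y, of "\<lambda>y. exp (a * y)", symmetric]) (auto simp: tilt)
  show "integrable M (\<lambda>\<omega>. Y \<omega> * exp (a * Y \<omega>))"
    using D by (subst distributed_integrable[OF Y, of "\<lambda>y. y * exp (a * y)", symmetric])
      (auto simp: tilt' intro!: integrable_normal_moment_nz_1)
  show "expectation (\<lambda>\<omega>. Y \<omega> * exp (a * Y \<omega>)) = a * D * exp (a\<^sup>2 * D / 2)"
    using D by (subst distributed_integral[OF Y, of "\<lambda>y. y * exp (a * y)", symmetric])
      (auto simp: tilt' integral_normal_moment_nz_1)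
qed

lemma (in prob_space) normal_second_moment:
  assumes Y: "distributed M lborel Y (normal_density 0 (sqrt D))" and D: "D > 0"
  shows "integrable M (\<lambda>\<omega>. (Y \<omega>)\<^sup>2)" and "expectation (\<lambda>\<omega>. (Y \<omega>)\<^sup>2) = D"
proof -
  show "integrable M (\<lambda>\<omega>. (Y \<omega>)\<^sup>2)"
    using D integrable_normal_moment[of "sqrt D" 0 2]
    by (subst distributed_integrable[OF Y, of "\<lambda>y. y\<^sup>2", symmetric]) auto
  show "expectation (\<lambda>\<omega>. (Y \<omega>)\<^sup>2) = D"
    using D integral_normal_moment_even[of "sqrt D" 0 1]
    by (subst distributed_integral[OF Y, of "\<lambda>y. y\<^sup>2", symmetric]) auto
qed

text \<open>For the process \<open>u = exp (- (c + b\<^sup>2/2) t + b w)\<close>, a time step \<open>D\<close> and a Brownian increment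
  \<open>y\<close>, this is the difference between the relative increment of \<open>u\<close> and its linearisation
  \<open>- c D + b y\<close>.\<close>

definition increment_error :: "real \<Rightarrow> real \<Rightarrow> real \<Rightarrow> real \<Rightarrow> real" where
  "increment_error b c D y = exp (b * y - (c + b\<^sup>2 / 2) * D) - 1 + c * D - b * y"

lemma (in prob_space) increment_error_moments:
  assumes Y: "distributed M lborel Y (normal_density 0 (sqrt D))" and D: "D > 0"
  shows "expectation (\<lambda>\<omega>. increment_error b c D (Y \<omega>)) = exp (- (c * D)) - 1 + c * D"
    and "integrable M (\<lambda>\<omega>. (increment_error b c D (Y \<omega>))\<^sup>2)"
    and "expectation (\<lambda>\<omega>. (increment_error b c D (Y \<omega>))\<^sup>2)
      = exp (b * b * D - 2 * c * D) + b * b * D + (1 - c * D)\<^sup>2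
        - 2 * b * b * D * exp (- (c * D)) - 2 * (1 - c * D) * exp (- (c * D))"
proof -
  define a where "a = c + b\<^sup>2 / 2"
  let ?k = "1 - c * D"
  note moments = normal_exponential_moment[OF Y D] normal_second_moment[OF Y D]
  have Y1: "integrable M Y" "expectation Y = 0"
    using moments(3,4)[of 0] by auto
  have [measurable]: "Y \<in> borel_measurable M"
    using Y1 by auto
  have err: "increment_error b c D y = exp (- (a * D)) * exp (b * y) - b * y - ?k" for y
    unfolding increment_error_def a_def mult_exp_exp by (simp add: algebra_simps)
  have sq: "(increment_error b c D y)\<^sup>2 = exp (- (2 * a * D)) * exp (2 * b * y) + b\<^sup>2 * y\<^sup>2 + ?k\<^sup>2
      - 2 * b * exp (- (a * D)) * (y * exp (b * y)) - 2 * ?k * exp (- (a * D)) * exp (b * y)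
      + 2 * b * ?k * y" for y
  proof -
    have "exp (- (2 * a * D)) = (exp (- (a * D)))\<^sup>2" "exp (2 * b * y) = (exp (b * y))\<^sup>2"
      by (simp_all add: exp_double[symmetric] algebra_simps)
    then show ?thesis
      unfolding err by (simp only: power2_eq_square algebra_simps)
  qed
  have e1: "exp (- (a * D)) * exp (b\<^sup>2 * D / 2) = exp (- (c * D))"
    unfolding mult_exp_exp a_def by (simp add: algebra_simps)
  have e2: "exp (- (2 * a * D)) * exp ((2 * b)\<^sup>2 * D / 2) = exp (b * b * D - 2 * c * D)"
    unfolding mult_exp_exp a_def by (simp add: algebra_simps power2_eq_square)
  show "expectation (\<lambda>\<omega>. increment_error b c D (Y \<omega>)) = exp (- (c * D)) - 1 + c * D"
    unfolding err using moments(1)[of b] Y1 by (simp add: moments(2) e1 prob_space)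
  show "integrable M (\<lambda>\<omega>. (increment_error b c D (Y \<omega>))\<^sup>2)"
    unfolding sq using moments(1,3)[of b] moments(1)[of "2 * b"] moments(5) Y1 by auto
  have "expectation (\<lambda>\<omega>. (increment_error b c D (Y \<omega>))\<^sup>2)
      = exp (- (2 * a * D)) * exp ((2 * b)\<^sup>2 * D / 2) + b\<^sup>2 * D + ?k\<^sup>2
        - 2 * b * exp (- (a * D)) * (b * D * exp (b\<^sup>2 * D / 2))
        - 2 * ?k * exp (- (a * D)) * exp (b\<^sup>2 * D / 2)"
    unfolding sq using moments(1,3)[of b] moments(1)[of "2 * b"] moments(5) Y1
    by (simp add: moments(2,4,6) prob_space)
  also have "\<dots> = exp (- (2 * a * D)) * exp ((2 * b)\<^sup>2 * D / 2) + b\<^sup>2 * D + ?k\<^sup>2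
        - 2 * b * b * D * (exp (- (a * D)) * exp (b\<^sup>2 * D / 2))
        - 2 * ?k * (exp (- (a * D)) * exp (b\<^sup>2 * D / 2))"
    by (simp only: mult_ac)
  finally show "expectation (\<lambda>\<omega>. (increment_error b c D (Y \<omega>))\<^sup>2)
      = exp (b * b * D - 2 * c * D) + b * b * D + (1 - c * D)\<^sup>2
        - 2 * b * b * D * exp (- (c * D)) - 2 * (1 - c * D) * exp (- (c * D))"
    unfolding e1 e2 by (simp add: power2_eq_square)
qed

text \<open>The two expressions are the mean and the second moment from \<open>increment_error_moments\<close>.  In both,
  the terms of order 0 and 1 in \<open>D\<close> cancel; in the second one the coefficients of \<open>D\<close> are
  \<open>- 2 c + b\<^sup>2\<close>, \<open>b\<^sup>2\<close>, \<open>- 2 c\<close>, \<open>- 2 b\<^sup>2\<close> and \<open>4 c\<close>.\<close>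

lemma increment_error_moments_quadratic:
  obtains K r :: real where "K > 0" "r > 0"
    "\<And>D. 0 < D \<Longrightarrow> D < r \<Longrightarrow> \<bar>exp (- (c * D)) - 1 + c * D\<bar> \<le> K * D\<^sup>2"
    "\<And>D. 0 < D \<Longrightarrow> D < r \<Longrightarrow>
      \<bar>exp (b * b * D - 2 * c * D) + b * b * D + (1 - c * D)\<^sup>2
        - 2 * b * b * D * exp (- (c * D)) - 2 * (1 - c * D) * exp (- (c * D))\<bar> \<le> K * D\<^sup>2"
proof -
  have "(\<lambda>D. exp (- (c * D)) - 1 + c * D) \<in> O[at_right 0](\<lambda>D. D\<^sup>2)"
    by real_asymp
  then obtain K1 where K1: "K1 > 0"
    "\<forall>\<^sub>F D in at_right 0. \<bar>exp (- (c * D)) - 1 + c * D\<bar> \<le> K1 * D\<^sup>2"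
    by (auto elim!: landau_o.bigE)
  have "(\<lambda>D. exp (b * b * D - 2 * c * D) + b * b * D + (1 - c * D)\<^sup>2
      - 2 * b * b * D * exp (- (c * D)) - 2 * (1 - c * D) * exp (- (c * D))) \<in> O[at_right 0](\<lambda>D. D\<^sup>2)"
    by real_asymp
  then obtain K2 where K2: "K2 > 0"
    "\<forall>\<^sub>F D in at_right 0. \<bar>exp (b * b * D - 2 * c * D) + b * b * D + (1 - c * D)\<^sup>2
      - 2 * b * b * D * exp (- (c * D)) - 2 * (1 - c * D) * exp (- (c * D))\<bar> \<le> K2 * D\<^sup>2"
    by (auto elim!: landau_o.bigE)
  from eventually_conj[OF K1(2) K2(2)] obtain r where r: "r > 0"
    "\<And>D. 0 < D \<Longrightarrow> D < r \<Longrightarrow> \<bar>exp (- (c * D)) - 1 + c * D\<bar> \<le> K1 * D\<^sup>2"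
    "\<And>D. 0 < D \<Longrightarrow> D < r \<Longrightarrow> \<bar>exp (b * b * D - 2 * c * D) + b * b * D + (1 - c * D)\<^sup>2
      - 2 * b * b * D * exp (- (c * D)) - 2 * (1 - c * D) * exp (- (c * D))\<bar> \<le> K2 * D\<^sup>2"
    unfolding eventually_at_right_field by blast
  have "K1 * D\<^sup>2 \<le> (K1 + K2) * D\<^sup>2" "K2 * D\<^sup>2 \<le> (K1 + K2) * D\<^sup>2" for D
    using K1(1) K2(1) by (auto intro!: mult_right_mono)
  then show thesis
    using r(1) K1(1) K2(1) order_trans[OF r(2)] order_trans[OF r(3)]
    by (intro that[of "K1 + K2" r]) (simp, assumption, blast+)
qed

section \<open>The stochastic integral of the logarithmic differential\<close>

lemma (in stochastic_basis) borel_measurable_F_imp_M: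
  "f \<in> borel_measurable (F t) \<Longrightarrow> 0 \<le> t \<Longrightarrow> f \<in> borel_measurable M"
  using measurable_from_subalg[OF subalgebra_F] .

lemma (in stochastic_basis) borel_measurable_F_mono:
  fixes f :: "'a \<Rightarrow> real"
  assumes "f \<in> borel_measurable (F s)" "0 \<le> s" "s \<le> t"
  shows "f \<in> borel_measurable (F t)"
proof (rule measurable_from_subalg[OF _ assms(1)])
  show "subalgebra (F t) (F s)"
    using mono_F[OF assms(2,3)] subalgebra_F[of s] subalgebra_F[of t] assms
    by (auto simp: subalgebra_def)
qed

lemma (in stochastic_basis) past_independent_of_increment:
  assumes bm: "brownian_motion w" and st: "0 \<le> s" "s < t"
    and V: "V \<in> borel_measurable (F s)" and g: "g \<in> borel_measurable borel"
  shows "indep_var borel (V :: 'a \<Rightarrow> real) borel (\<lambda>\<omega>. g (w t \<omega> - w s \<omega>) :: real)"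
proof -
  let ?Y = "\<lambda>\<omega>. w t \<omega> - w s \<omega>"
  have ind: "indep_set (sets (F s)) (sets (vimage_algebra (space M) ?Y borel))"
    using bm st by (auto simp: brownian_motion_def)
  have wM: "w r \<in> borel_measurable M" if "0 \<le> r" for r
    using bm that by (auto simp: brownian_motion_def intro: borel_measurable_F_imp_M)
  have [measurable]: "?Y \<in> borel_measurable M"
    using wM[of s] wM[of t] st by auto
  have VM: "V \<in> borel_measurable M"
    using borel_measurable_F_imp_M[OF V st(1)] .
  have sp: "space (F s) = space M"
    using subalgebra_F[OF st(1)] by (auto simp: subalgebra_def)
  have sub1: "sigma_sets (space M) {V -` A \<inter> space M |A. A \<in> sets borel} \<subseteq> sets (F s)"
    unfolding sp[symmetric]
    by (rule sets.sigma_sets_subset) (auto intro: measurable_sets[OF V])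
  have "indep_set (sigma_sets (space M) {V -` A \<inter> space M |A. A \<in> sets borel})
      (sigma_sets (space M) {?Y -` A \<inter> space M |A. A \<in> sets borel})"
    using ind sub1 unfolding indep_sets2_eq by (auto simp: sets_vimage_algebra)
  then have "indep_var borel V borel ?Y"
    unfolding indep_var_eq using VM by auto
  from indep_var_compose[OF this measurable_ident g] show ?thesis
    by (simp add: comp_def)
qed

lemma partition_times:
  fixes p :: "nat \<Rightarrow> real"
  assumes "p 0 = 0" "p m = T" "\<And>i. i < m \<Longrightarrow> 0 < p (Suc i) - p i" "i \<le> m"
  shows "0 \<le> p i" "p i \<le> T"
proof -
  have "i \<le> m \<Longrightarrow> 0 \<le> p i" for i
  proof (induction i)
    case (Suc i)
    then show ?case using assms(3)[of i] by simp
  qed (use assms in simp)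
  then show "0 \<le> p i" using assms by blast
  show "p i \<le> T"
    using \<open>i \<le> m\<close>
  proof (induction i rule: inc_induct)
    case (step n)
    then show ?case using assms(3)[of n] by simp
  qed (use assms in simp)
qed

text \<open>The moments of the single errors are quadratic in the interval lengths, and the squared lengths
  sum to at most \<open>T\<close> times the mesh.\<close>

lemma (in stochastic_basis) accumulated_error_second_moment:
  assumes bm: "brownian_motion w"
    and p: "p 0 = 0" "p m = T" "\<And>i. i < m \<Longrightarrow> 0 < p (Suc i) - p i"
      "\<And>i. i < m \<Longrightarrow> p (Suc i) - p i < \<delta>"
    and K: "K > 0" and "\<delta> \<le> r"
    and mean: "\<And>D. 0 < D \<Longrightarrow> D < r \<Longrightarrow> \<bar>exp (- (c * D)) - 1 + c * D\<bar> \<le> K * D\<^sup>2"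
    and second: "\<And>D. 0 < D \<Longrightarrow> D < r \<Longrightarrow>
      \<bar>exp (b * b * D - 2 * c * D) + b * b * D + (1 - c * D)\<^sup>2
        - 2 * b * b * D * exp (- (c * D)) - 2 * (1 - c * D) * exp (- (c * D))\<bar> \<le> K * D\<^sup>2"
  defines "V \<equiv> \<lambda>\<omega>. \<Sum>i<m. increment_error b c (p (Suc i) - p i) (w (p (Suc i)) \<omega> - w (p i) \<omega>)"
  shows "V \<in> borel_measurable M"
    and "integrable M (\<lambda>\<omega>. (V \<omega>)\<^sup>2)"
    and "expectation (\<lambda>\<omega>. (V \<omega>)\<^sup>2) \<le> (K * T * \<delta>)\<^sup>2 + K * T * \<delta>"
proof -
  define D where "D i = p (Suc i) - p i" for i
  define Z where "Z i \<omega> = increment_error b c (D i) (w (p (Suc i)) \<omega> - w (p i) \<omega>)" for i \<omega>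
  have D: "0 < D i" "D i < \<delta>" "D i < r" if "i < m" for i
    using p(3,4)[OF that] \<open>\<delta> \<le> r\<close> by (auto simp: D_def)
  have p0: "0 \<le> p i" if "i \<le> m" for i
    using partition_times(1)[OF p(1-3)] that by blast
  have err_meas: "increment_error b c d \<in> borel_measurable borel" for d
    unfolding increment_error_def[abs_def] by measurable
  have wF: "w (p i) \<in> borel_measurable (F (p j))" if "i \<le> j" "j \<le> m" for i j
  proof (rule borel_measurable_F_mono)
    show "w (p i) \<in> borel_measurable (F (p i))"
      using bm p0[of i] that by (auto simp: brownian_motion_def)
    show "0 \<le> p i" using p0 that by auto
    show "p i \<le> p j" using that
    proof (induction j rule: dec_induct)
      case (step k)
      then show ?case using p(3)[of k] by auto
    qed simp
  qed
  have ZF: "Z i \<in> borel_measurable (F (p j))" if "i < j" "j \<le> m" for i j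
  proof -
    have [measurable]: "w (p i) \<in> borel_measurable (F (p j))"
        "w (p (Suc i)) \<in> borel_measurable (F (p j))"
      using that by (auto intro!: wF)
    show ?thesis unfolding Z_def increment_error_def by measurable
  qed
  have ZM: "Z i \<in> borel_measurable M" if "i < m" for i
    using ZF[of i m] p0[of m] that by (auto intro: borel_measurable_F_imp_M)
  have dist: "distributed M lborel (\<lambda>\<omega>. w (p (Suc i)) \<omega> - w (p i) \<omega>) (normal_density 0 (sqrt (D i)))"
    if "i < m" for i
    using bm p0[of i] p(3)[OF that] that by (auto simp: brownian_motion_def D_def)
  note mom = increment_error_moments[OF dist D(1), of _ b c, folded Z_def]
  have ind: "indep_var borel (\<lambda>\<omega>. \<Sum>j<i. Z j \<omega>) borel (Z i)" if "i < m" for i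
    unfolding Z_def[of i]
  proof (rule past_independent_of_increment[OF bm _ _ _ err_meas])
    show "0 \<le> p i" "p i < p (Suc i)" using p0[of i] p(3)[of i] that by auto
    show "(\<lambda>\<omega>. \<Sum>j<i. Z j \<omega>) \<in> borel_measurable (F (p i))"
      using that by (intro borel_measurable_sum ZF) auto
  qed
  have V: "V = (\<lambda>\<omega>. \<Sum>i<m. Z i \<omega>)"
    by (simp add: V_def Z_def D_def)
  show "V \<in> borel_measurable M"
    unfolding V using ZM by (intro borel_measurable_sum) auto
  show "integrable M (\<lambda>\<omega>. (V \<omega>)\<^sup>2)"
    unfolding V using ZM mom(2) ind by (intro second_moment_sum_independent_of_past(1)) auto
  have sumD: "(\<Sum>i<m. K * (D i)\<^sup>2) \<le> K * T * \<delta>"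
  proof -
    have "(\<Sum>i<m. K * (D i)\<^sup>2) \<le> (\<Sum>i<m. K * \<delta> * D i)"
      using D K by (intro sum_mono) (auto simp: power2_eq_square intro!: mult_left_mono mult_right_mono less_imp_le)
    also have "\<dots> = K * \<delta> * T"
      using p(1,2) by (simp add: sum_distrib_left[symmetric] D_def sum_lessThan_telescope)
    finally show ?thesis by (simp add: mult_ac)
  qed
  have "\<bar>\<Sum>i<m. expectation (Z i)\<bar> \<le> (\<Sum>i<m. K * (D i)\<^sup>2)"
    using mom(1) mean D by (intro order_trans[OF sum_abs] sum_mono) auto
  then have m1: "\<bar>\<Sum>i<m. expectation (Z i)\<bar> \<le> K * T * \<delta>"
    using sumD by linarith
  have "(\<Sum>i<m. expectation (\<lambda>\<omega>. (Z i \<omega>)\<^sup>2)) \<le> (\<Sum>i<m. K * (D i)\<^sup>2)"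
  proof (rule sum_mono)
    fix i assume "i \<in> {..<m}"
    then have i: "i < m" by simp
    show "expectation (\<lambda>\<omega>. (Z i \<omega>)\<^sup>2) \<le> K * (D i)\<^sup>2"
      using order_trans[OF abs_ge_self second[of "D i"]] D[OF i] mom(3)[OF i i] by metis
  qed
  then have m2: "(\<Sum>i<m. expectation (\<lambda>\<omega>. (Z i \<omega>)\<^sup>2)) \<le> K * T * \<delta>"
    using sumD by linarith
  have "expectation (\<lambda>\<omega>. (V \<omega>)\<^sup>2)
      \<le> (\<Sum>i<m. expectation (Z i))\<^sup>2 + (\<Sum>i<m. expectation (\<lambda>\<omega>. (Z i \<omega>)\<^sup>2))"
    unfolding V using ZM mom(2) ind by (intro second_moment_sum_independent_of_past(2)) auto
  also have "(\<Sum>i<m. expectation (Z i))\<^sup>2 \<le> (K * T * \<delta>)\<^sup>2"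
    using m1 by (metis abs_ge_zero power2_abs power_mono)
  finally show "expectation (\<lambda>\<omega>. (V \<omega>)\<^sup>2) \<le> (K * T * \<delta>)\<^sup>2 + K * T * \<delta>"
    using m2 by linarith
qed

text \<open>The process \<open>u\<close> solves \<open>du = - c u dt + b u dw\<close>, so \<open>du / u\<close> is formally \<open>- c dt + b dw\<close>.\<close>

lemma (in stochastic_basis) has_ito_integral_logarithmic_differential:
  fixes b c :: real and v :: "'a \<Rightarrow> real"
  assumes bm: "brownian_motion w" and T: "0 < T"
    and v: "v \<in> borel_measurable (F 0)" "AE \<omega> in M. v \<omega> \<noteq> 0"
  defines "u \<equiv> \<lambda>t \<omega>. v \<omega> * exp (- (c + b\<^sup>2 / 2) * t + b * w t \<omega>)"
  shows "has_ito_integral M F T (\<lambda>t \<omega>. 1 / u t \<omega>) u (\<lambda>\<omega>. - c * T + b * w T \<omega>)"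
proof -
  have vt: "v \<in> borel_measurable (F t)" if "0 \<le> t" for t
    using borel_measurable_F_mono[OF v(1)] that by auto
  have wt: "w t \<in> borel_measurable (F t)" if "0 \<le> t" for t
    using bm that by (auto simp: brownian_motion_def)
  have ut: "u t \<in> borel_measurable (F t)" if "0 \<le> t" for t
    unfolding u_def using vt[OF that] wt[OF that] by measurable
  have cont: "AE \<omega> in M. continuous_on {0..T} (\<lambda>t. w t \<omega>)"
  proof -
    have "AE \<omega> in M. continuous_on {0..} (\<lambda>t. w t \<omega>)"
      using bm by (simp add: brownian_motion_def)
    then show ?thesis
      by eventually_elim (auto elim: continuous_on_subset)
  qed
  have u_cont: "AE \<omega> in M. continuous_on {0..T} (\<lambda>t. u t \<omega>)"
    using cont by eventually_elim (auto simp: u_def intro!: continuous_intros)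
  have inv_cont: "AE \<omega> in M. continuous_on {0..T} (\<lambda>t. 1 / u t \<omega>)"
    using u_cont v(2) by eventually_elim (auto simp: u_def intro!: continuous_intros)
  have w0: "AE \<omega> in M. w 0 \<omega> = 0"
    using bm by (auto simp: brownian_motion_def)
  let ?J = "\<lambda>\<omega>. - c * T + b * w T \<omega>"
  have wM: "w t \<in> borel_measurable M" if "0 \<le> t" for t
    using borel_measurable_F_imp_M[OF wt] that by auto
  have JM: "?J \<in> borel_measurable M"
    using wM[of T] T by auto
  obtain K r where K: "K > 0" "r > 0"
    and mean: "\<And>D. 0 < D \<Longrightarrow> D < r \<Longrightarrow> \<bar>exp (- (c * D)) - 1 + c * D\<bar> \<le> K * D\<^sup>2"
    and second: "\<And>D. 0 < D \<Longrightarrow> D < r \<Longrightarrow>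
      \<bar>exp (b * b * D - 2 * c * D) + b * b * D + (1 - c * D)\<^sup>2
        - 2 * b * b * D * exp (- (c * D)) - 2 * (1 - c * D) * exp (- (c * D))\<bar> \<le> K * D\<^sup>2"
    using increment_error_moments_quadratic[of c b] by metis
  have "\<exists>\<delta>>0. \<forall>p m. p 0 = 0 \<and> p m = T \<and> (\<forall>i<m. 0 < p (Suc i) - p i \<and> p (Suc i) - p i < \<delta>) \<longrightarrow>
      measure M {\<omega> \<in> space M. \<bar>left_sum (\<lambda>t \<omega>. 1 / u t \<omega>) u p m \<omega> - ?J \<omega>\<bar> > \<epsilon>} < \<eta>"
    if eps: "\<epsilon> > 0" "\<eta> > 0" for \<epsilon> \<eta> :: real
  proof -
    \<comment> \<open>The second moment of the total error is at most \<open>(K T \<delta>)\<^sup>2 + K T \<delta>\<close>.  With \<open>K T \<delta> \<le> s \<le> 1\<close>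
      this is at most \<open>2 s\<close>, and Chebyshev's bound \<open>2 s / \<epsilon>\<^sup>2\<close> has to stay below \<open>\<eta>\<close>.\<close>
    define s where "s = min 1 (\<epsilon>\<^sup>2 * \<eta> / 4)"
    have s: "0 < s" "s \<le> 1" "s \<le> \<epsilon>\<^sup>2 * \<eta> / 4" using eps by (auto simp: s_def)
    define \<delta> where "\<delta> = min r (s / (K * T))"
    have \<delta>: "0 < \<delta>" "\<delta> \<le> r" using K s T by (auto simp: \<delta>_def)
    have "\<delta> \<le> s / (K * T)" by (simp add: \<delta>_def)
    then have KTs: "K * T * \<delta> \<le> s"
      using K T by (simp add: field_simps)
    show ?thesis
    proof (intro exI[of _ \<delta>] conjI allI impI \<delta>(1))
      fix p :: "nat \<Rightarrow> real" and m
      assume "p 0 = 0 \<and> p m = T \<and> (\<forall>i<m. 0 < p (Suc i) - p i \<and> p (Suc i) - p i < \<delta>)"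
      then have p: "p 0 = 0" "p m = T" "\<And>i. i < m \<Longrightarrow> 0 < p (Suc i) - p i"
          "\<And>i. i < m \<Longrightarrow> p (Suc i) - p i < \<delta>"
        by auto
      define V where "V \<omega> = (\<Sum>i<m. increment_error b c (p (Suc i) - p i)
        (w (p (Suc i)) \<omega> - w (p i) \<omega>))" for \<omega>
      note V_bounds = accumulated_error_second_moment
        [OF bm p K(1) \<delta>(2) mean second, folded V_def]
      have [measurable]: "V \<in> borel_measurable M"
        using V_bounds(1) .
      have eq: "left_sum (\<lambda>t \<omega>. 1 / u t \<omega>) u p m \<omega> - ?J \<omega> = V \<omega>"
        if "v \<omega> \<noteq> 0" "w 0 \<omega> = 0" for \<omega>
      proof -
        have "1 / u (p i) \<omega> * (u (p (Suc i)) \<omega> - u (p i) \<omega>)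
          = increment_error b c (p (Suc i) - p i) (w (p (Suc i)) \<omega> - w (p i) \<omega>)
            + (- c * (p (Suc i) - p i) + b * (w (p (Suc i)) \<omega> - w (p i) \<omega>))" for i
        proof -
          have "1 / u (p i) \<omega> * (u (p (Suc i)) \<omega> - u (p i) \<omega>) = u (p (Suc i)) \<omega> / u (p i) \<omega> - 1"
            using that by (simp add: u_def field_simps)
          also have "u (p (Suc i)) \<omega> / u (p i) \<omega>
              = exp (b * (w (p (Suc i)) \<omega> - w (p i) \<omega>) - (c + b\<^sup>2 / 2) * (p (Suc i) - p i))"
            using that by (simp add: u_def exp_diff[symmetric]) (simp add: field_simps)
          finally show ?thesis
            by (simp add: increment_error_def algebra_simps)
        qed
        then have "left_sum (\<lambda>t \<omega>. 1 / u t \<omega>) u p m \<omega> = V \<omega>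
          + (\<Sum>i<m. - c * (p (Suc i) - p i) + b * (w (p (Suc i)) \<omega> - w (p i) \<omega>))"
          by (simp add: left_sum_def V_def sum.distrib)
        also have "(\<Sum>i<m. - c * (p (Suc i) - p i) + b * (w (p (Suc i)) \<omega> - w (p i) \<omega>)) = ?J \<omega>"
          unfolding sum.distrib sum_distrib_left[symmetric]
            sum_lessThan_telescope[of p m] sum_lessThan_telescope[of "\<lambda>i. w (p i) \<omega>" m]
          using p(1,2) that by simp
        finally show ?thesis by simp
      qed
      have "measure M {\<omega> \<in> space M. \<bar>left_sum (\<lambda>t \<omega>. 1 / u t \<omega>) u p m \<omega> - ?J \<omega>\<bar> > \<epsilon>}
          \<le> measure M {\<omega> \<in> space M. \<bar>V \<omega>\<bar> \<ge> \<epsilon>}"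
      proof (rule finite_measure_mono_AE)
        show "AE \<omega> in M. \<omega> \<in> {\<omega> \<in> space M. \<bar>left_sum (\<lambda>t \<omega>. 1 / u t \<omega>) u p m \<omega> - ?J \<omega>\<bar> > \<epsilon>}
            \<longrightarrow> \<omega> \<in> {\<omega> \<in> space M. \<bar>V \<omega>\<bar> \<ge> \<epsilon>}"
          using v(2) w0
        proof eventually_elim
          case (elim \<omega>)
          then show ?case
            unfolding mem_Collect_eq eq[OF elim] by auto
        qed
      qed simp
      also have "\<dots> \<le> expectation (\<lambda>\<omega>. (V \<omega>)\<^sup>2) / \<epsilon>\<^sup>2"
        by (rule second_moment_method) (use V_bounds eps in auto)
      also have "\<dots> \<le> (s + s) / \<epsilon>\<^sup>2"
      proof (rule divide_right_mono)
        have "0 \<le> K * T * \<delta>" using K T \<delta> by simp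
        then have "(K * T * \<delta>)\<^sup>2 \<le> s * 1"
          unfolding power2_eq_square using KTs s(2) by (intro mult_mono) auto
        then show "expectation (\<lambda>\<omega>. (V \<omega>)\<^sup>2) \<le> s + s"
          using V_bounds(3) KTs by linarith
      qed simp
      also have "\<dots> \<le> \<eta> / 2"
        using s(3) eps by (simp add: field_simps)
      also have "\<dots> < \<eta>" using eps by simp
      finally show "measure M {\<omega> \<in> space M.
        \<bar>left_sum (\<lambda>t \<omega>. 1 / u t \<omega>) u p m \<omega> - ?J \<omega>\<bar> > \<epsilon>} < \<eta>" .
    qed
  qed
  then show ?thesis
    using ut u_cont inv_cont JM
    by (auto simp: has_ito_integral_def continuous_adapted_def)
qed

lemma (in stochastic_basis) has_ito_integral_unique_AE:
  assumes T: "0 < T"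
    and J: "has_ito_integral M F T X Y J" and J': "has_ito_integral M F T X Y J'"
  shows "AE \<omega> in M. J \<omega> = J' \<omega>"
proof -
  have [measurable]: "J \<in> borel_measurable M" "J' \<in> borel_measurable M"
    using J J' by (auto simp: has_ito_integral_def)
  have XY: "X t \<in> borel_measurable M" "Y t \<in> borel_measurable M" if "t \<in> {0..T}" for t
  proof -
    have "X t \<in> borel_measurable (F t)" "Y t \<in> borel_measurable (F t)" "0 \<le> t"
      using J that by (auto simp: has_ito_integral_def continuous_adapted_def)
    then show "X t \<in> borel_measurable M" "Y t \<in> borel_measurable M"
      by (auto intro: borel_measurable_F_imp_M)
  qed
  have null: "measure M {\<omega> \<in> space M. \<bar>J \<omega> - J' \<omega>\<bar> > 2 * \<epsilon>} = 0" if \<epsilon>: "\<epsilon> > 0" for \<epsilon> :: real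
  proof -
    have "measure M {\<omega> \<in> space M. \<bar>J \<omega> - J' \<omega>\<bar> > 2 * \<epsilon>} \<le> 0 + \<eta>" if \<eta>: "\<eta> > 0" for \<eta> :: real
    proof -
      have "\<eta> / 2 > 0" using \<eta> by simp
      with J \<epsilon> obtain \<delta> where \<delta>: "\<delta> > 0" "\<And>p m. p 0 = 0 \<and> p m = T \<and>
          (\<forall>i<m. 0 < p (Suc i) - p i \<and> p (Suc i) - p i < \<delta>) \<Longrightarrow>
          measure M {\<omega> \<in> space M. \<bar>left_sum X Y p m \<omega> - J \<omega>\<bar> > \<epsilon>} < \<eta> / 2"
        unfolding has_ito_integral_def by blast
      from J' \<epsilon> \<open>\<eta> / 2 > 0\<close> obtain \<delta>' where \<delta>': "\<delta>' > 0" "\<And>p m. p 0 = 0 \<and> p m = T \<and>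
          (\<forall>i<m. 0 < p (Suc i) - p i \<and> p (Suc i) - p i < \<delta>') \<Longrightarrow>
          measure M {\<omega> \<in> space M. \<bar>left_sum X Y p m \<omega> - J' \<omega>\<bar> > \<epsilon>} < \<eta> / 2"
        unfolding has_ito_integral_def by blast
      obtain n :: nat where n: "T / min \<delta> \<delta>' < n"
        using reals_Archimedean2 by blast
      then have n0: "0 < real n"
        using T \<delta>(1) \<delta>'(1) by (intro le_less_trans[OF _ n]) auto
      \<comment> \<open>A uniform partition fine enough for both integrals; its left-endpoint sum is within \<open>\<epsilon>\<close> of
        \<open>J\<close> and of \<open>J'\<close> outside an event of probability less than \<open>\<eta>\<close>.\<close>
      define p where "p i = T * real i / real n" for i
      have step: "p (Suc i) - p i = T / n" for i
        by (simp add: p_def diff_divide_distrib[symmetric] algebra_simps)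
      have "T < min \<delta> \<delta>' * real n"
        using n \<delta>(1) \<delta>'(1) by (simp add: pos_divide_less_eq mult.commute)
      moreover have "min \<delta> \<delta>' * real n \<le> \<delta> * real n" "min \<delta> \<delta>' * real n \<le> \<delta>' * real n"
        by (intro mult_right_mono; simp)+
      ultimately have mesh: "T < \<delta> * real n" "T < \<delta>' * real n"
        by linarith+
      have p: "p 0 = 0" "p n = T" "0 < p (Suc i) - p i" "p (Suc i) - p i < \<delta>"
          "p (Suc i) - p i < \<delta>'" for i
        unfolding step using mesh n0 T by (auto simp: p_def field_simps)
      have p_in: "p i \<in> {0..T}" if "i \<le> n" for i
        using that n0 T by (auto simp: p_def field_simps)
      have "(\<lambda>\<omega>. left_sum X Y p n \<omega>) \<in> borel_measurable M"
        unfolding left_sum_def using XY p_in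
        by (intro borel_measurable_sum borel_measurable_times borel_measurable_diff) auto
      then have [measurable]: "left_sum X Y p n \<in> borel_measurable M" by simp
      let ?A = "{\<omega> \<in> space M. \<bar>left_sum X Y p n \<omega> - J \<omega>\<bar> > \<epsilon>}"
      let ?B = "{\<omega> \<in> space M. \<bar>left_sum X Y p n \<omega> - J' \<omega>\<bar> > \<epsilon>}"
      have "measure M {\<omega> \<in> space M. \<bar>J \<omega> - J' \<omega>\<bar> > 2 * \<epsilon>} \<le> measure M (?A \<union> ?B)"
        by (rule finite_measure_mono) auto
      also have "\<dots> \<le> measure M ?A + measure M ?B"
        by (rule measure_Un_le) auto
      also have "\<dots> \<le> 0 + \<eta>"
        using \<delta>(2)[of p n] \<delta>'(2)[of p n] p by auto
      finally show ?thesis .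
    qed
    then show ?thesis
      using field_le_epsilon[of "measure M {\<omega> \<in> space M. \<bar>J \<omega> - J' \<omega>\<bar> > 2 * \<epsilon>}" 0]
      by (auto intro: antisym)
  qed
  have "AE \<omega> in M. \<forall>n. \<bar>J \<omega> - J' \<omega>\<bar> \<le> 2 * (1 / real (Suc n))"
    unfolding AE_all_countable
  proof
    fix n
    have "{\<omega> \<in> space M. \<bar>J \<omega> - J' \<omega>\<bar> > 2 * (1 / real (Suc n))} \<in> null_sets M"
      using null[of "1 / real (Suc n)"] by (auto simp: null_sets_def emeasure_eq_measure)
    then show "AE \<omega> in M. \<bar>J \<omega> - J' \<omega>\<bar> \<le> 2 * (1 / real (Suc n))"
      by (rule AE_I') auto
  qed
  then show ?thesis
  proof eventually_elim
    case (elim \<omega>)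
    have "(\<lambda>n. 2 * (1 / real (Suc n))) \<longlonglongrightarrow> 0"
      by real_asymp
    then have "\<bar>J \<omega> - J' \<omega>\<bar> \<le> 0"
      by (rule LIMSEQ_le_const) (use elim in auto)
    then show ?case by simp
  qed
qed

lemma (in stochastic_basis) ito_integral_AE_eq:
  assumes "0 < T" "has_ito_integral M F T X Y J"
  shows "AE \<omega> in M. ito_integral M F T X Y \<omega> = J \<omega>"
proof (rule has_ito_integral_unique_AE[OF assms(1) _ assms(2)])
  show "has_ito_integral M F T X Y (ito_integral M F T X Y)"
    unfolding ito_integral_def
    by (rule someI[of "has_ito_integral M F T X Y", OF assms(2)])
qed

section \<open>Almost sure convergence from fourth moments\<close>

text \<open>By monotone convergence the series of the variables has finite expectation, hence converges
  almost surely, and so its terms vanish.\<close>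

lemma (in prob_space) AE_tendsto_zero_if_summable_expectation:
  fixes X :: "nat \<Rightarrow> 'a \<Rightarrow> real"
  assumes int: "\<And>n. integrable M (X n)" and nonneg: "\<And>n \<omega>. 0 \<le> X n \<omega>"
    and sum: "summable (\<lambda>n. expectation (X n))"
  shows "AE \<omega> in M. (\<lambda>n. X n \<omega>) \<longlonglongrightarrow> 0"
proof -
  have [measurable]: "X n \<in> borel_measurable M" for n
    using int by auto
  have "(\<integral>\<^sup>+\<omega>. (\<Sum>n. ennreal (X n \<omega>)) \<partial>M) = (\<Sum>n. ennreal (expectation (X n)))"
    by (subst nn_integral_suminf) (auto simp: nn_integral_eq_integral int nonneg)
  also have "\<dots> \<noteq> \<infinity>"
    using sum nonneg by (simp add: ennreal_suminf_neq_top)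
  finally have "AE \<omega> in M. (\<Sum>n. ennreal (X n \<omega>)) \<noteq> \<infinity>"
    by (intro nn_integral_PInf_AE) auto
  then show ?thesis
    by eventually_elim (auto intro!: summable_LIMSEQ_zero summable_suminf_not_top nonneg)
qed

text \<open>Fourth moments are used because the variances \<open>1 / I n\<close> need not be summable: they decay only
  like \<open>1 / n\<close> when \<open>I\<close> grows linearly.\<close>

lemma (in prob_space) std_normal_div_sqrt_tendsto_zero:
  fixes \<xi> :: "nat \<Rightarrow> 'a \<Rightarrow> real"
  assumes \<xi>: "\<And>n. n \<ge> 1 \<Longrightarrow> distributed M lborel (\<xi> n) std_normal_density"
    and I: "\<And>n. n \<ge> 1 \<Longrightarrow> I n > 0" and sum: "summable (\<lambda>n. 1 / (I n)\<^sup>2)"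
  shows "AE \<omega> in M. (\<lambda>n. \<xi> n \<omega> / sqrt (I n)) \<longlonglongrightarrow> 0"
proof -
  let ?X = "\<lambda>n \<omega>. (\<xi> (Suc n) \<omega>) ^ 4 / (I (Suc n))\<^sup>2"
  have int: "integrable M (\<lambda>\<omega>. (\<xi> (Suc n) \<omega>) ^ 4)"
    and E: "expectation (\<lambda>\<omega>. (\<xi> (Suc n) \<omega>) ^ 4) = 3" for n
  proof -
    show "integrable M (\<lambda>\<omega>. (\<xi> (Suc n) \<omega>) ^ 4)"
      using integrable_std_normal_moment[of 4]
      by (subst distributed_integrable[OF \<xi>, of _ "\<lambda>y. y ^ 4", symmetric]) auto
    show "expectation (\<lambda>\<omega>. (\<xi> (Suc n) \<omega>) ^ 4) = 3"
      using integral_std_normal_moment_even[of 2]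
      by (subst distributed_integral[OF \<xi>, of _ "\<lambda>y. y ^ 4", symmetric]) (auto simp: fact_numeral)
  qed
  have "AE \<omega> in M. (\<lambda>n. ?X n \<omega>) \<longlonglongrightarrow> 0"
  proof (rule AE_tendsto_zero_if_summable_expectation)
    have "summable (\<lambda>n. 3 * (1 / (I (Suc n))\<^sup>2))"
      using sum summable_Suc_iff[of "\<lambda>n. 1 / (I n)\<^sup>2"] by (intro summable_mult) blast
    then show "summable (\<lambda>n. expectation (?X n))"
      using int by (simp add: E)
  qed (use int in auto)
  then show ?thesis
  proof eventually_elim
    case (elim \<omega>)
    have "?X n \<omega> = (\<xi> (Suc n) \<omega> / sqrt (I (Suc n))) ^ 4" for n
      using I[of "Suc n"] power_mult[of "sqrt (I (Suc n))" 2 2] by (simp add: power_divide)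
    moreover have "root 4 (x ^ 4) = \<bar>x\<bar>" for x :: real
      using real_root_power_cancel[of 4 "\<bar>x\<bar>"] by simp
    ultimately have "(\<lambda>n. root 4 (?X n \<omega>)) = (\<lambda>n. \<bar>\<xi> (Suc n) \<omega> / sqrt (I (Suc n))\<bar>)"
      by presburger
    moreover have "(\<lambda>n. root 4 (?X n \<omega>)) \<longlonglongrightarrow> root 4 0"
      by (intro tendsto_real_root elim)
    ultimately have "(\<lambda>n. \<xi> (Suc n) \<omega> / sqrt (I (Suc n))) \<longlonglongrightarrow> 0"
      by (simp only: real_root_zero tendsto_rabs_zero_iff)
    then show ?case
      by (rule LIMSEQ_imp_Suc)
  qed
qed

text \<open>Well-posedness gives \<open>\<sigma>\<^sup>2 q\<^sub>k\<^sup>2 \<le> 2 \<theta> \<mu>\<^sub>k\<close> for large \<open>k\<close>.  Together with \<open>\<mu>\<^sub>k \<ge> 1\<close> this bounds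
  each summand of the Fisher information below by \<open>\<sigma>\<^sup>2 / (2 \<theta>)\<close>, so the sum grows at least
  linearly.\<close>

lemma summable_inverse_square_fisher_information:
  assumes \<mu>: "\<And>k. k \<ge> 1 \<Longrightarrow> \<mu> k > 0" "filterlim \<mu> at_top sequentially"
    and q: "\<And>k. k \<ge> 1 \<Longrightarrow> q k > 0" and pos: "\<sigma> > 0" "T > 0"
    and wp: "\<theta> > 0" "well_posed \<mu> q \<sigma> \<theta>"
  shows "summable (\<lambda>N. 1 / (fisher_information \<mu> q \<sigma> T N)\<^sup>2)"
proof -
  let ?a = "\<lambda>k. (\<mu> k)\<^sup>2 / (q k)\<^sup>2"
  define d where "d = \<sigma>\<^sup>2 / (2 * \<theta>)"
  have d: "d > 0" using pos wp by (simp add: d_def)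
  from wp obtain N0 e where N0: "N0 \<ge> 1" "e > 0"
    "\<And>k. k \<ge> N0 \<Longrightarrow> 2 * \<theta> - \<sigma>\<^sup>2 * (q k)\<^sup>2 / \<mu> k \<ge> e"
    unfolding well_posed_def by blast
  obtain N1 where N1: "\<And>k. k \<ge> N1 \<Longrightarrow> \<mu> k \<ge> 1"
    using \<mu>(2) unfolding filterlim_at_top eventually_sequentially by blast
  define K where "K = max N0 N1"
  have a_ge: "?a k \<ge> d" if "k \<ge> K" for k
  proof -
    have k: "k \<ge> 1" "k \<ge> N0" "\<mu> k \<ge> 1" using that N0(1) N1 by (auto simp: K_def)
    have "\<sigma>\<^sup>2 * (q k)\<^sup>2 / \<mu> k \<le> 2 * \<theta>"
      using N0(3)[OF k(2)] N0(2) by linarith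
    then have le: "\<sigma>\<^sup>2 * (q k)\<^sup>2 \<le> 2 * \<theta> * \<mu> k"
      using k by (simp add: field_simps)
    also have "\<dots> \<le> 2 * \<theta> * (\<mu> k)\<^sup>2"
      using k wp by (intro mult_left_mono) (auto simp: power2_eq_square)
    finally show ?thesis
      using q[OF k(1)] wp by (simp add: d_def field_simps)
  qed
  have a_nonneg: "?a k \<ge> 0" for k by simp
  define \<kappa> where "\<kappa> = T / \<sigma>\<^sup>2 * (d / 2)"
  have \<kappa>: "\<kappa> > 0" using pos d by (simp add: \<kappa>_def)
  have I_ge: "fisher_information \<mu> q \<sigma> T N \<ge> \<kappa> * N" if "N \<ge> 2 * K" for N
  proof -
    have "d / 2 * N \<le> d * (real N - real K)"
    proof -
      have "real N / 2 \<le> real N - real K" using that by simp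
      then show ?thesis using d mult_left_mono[of "real N / 2" "real N - real K" d] by simp
    qed
    also have "\<dots> = (\<Sum>k=K+1..N. d)"
      using that by (simp add: of_nat_diff)
    also have "\<dots> \<le> (\<Sum>k=K+1..N. ?a k)"
      by (intro sum_mono a_ge) auto
    also have "\<dots> \<le> (\<Sum>k=1..N. ?a k)"
      by (intro sum_mono2) auto
    finally show ?thesis
      unfolding fisher_information_def \<kappa>_def mult.assoc
      using pos by (intro mult_left_mono) auto
  qed
  show ?thesis
  proof (rule summable_comparison_test'[where N = "2 * K + 1"])
    show "summable (\<lambda>N. 1 / \<kappa>\<^sup>2 * (1 / real N ^ 2))"
      using inverse_power_summable[of 2, where 'a = real]
      by (intro summable_mult) (simp add: field_simps)
    fix N assume N: "N \<ge> 2 * K + 1"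
    have pos': "0 < \<kappa> * N" using \<kappa> N by simp
    have "(\<kappa> * N)\<^sup>2 \<le> (fisher_information \<mu> q \<sigma> T N)\<^sup>2"
      using I_ge[of N] N pos' by (intro power_mono) auto
    then have "1 / (fisher_information \<mu> q \<sigma> T N)\<^sup>2 \<le> 1 / (\<kappa> * N)\<^sup>2"
      using pos' by (intro divide_left_mono mult_pos_pos) (use N in auto)
    then show "norm (1 / (fisher_information \<mu> q \<sigma> T N)\<^sup>2) \<le> 1 / \<kappa>\<^sup>2 * (1 / real N ^ 2)"
      by (simp add: power_mult_distrib)
  qed
qed

section \<open>The estimation error\<close>

text \<open>The independent terms \<open>\<mu>\<^sub>k / q\<^sub>k w\<^sub>k(T)\<close> have variances \<open>T \<mu>\<^sub>k\<^sup>2 / q\<^sub>k\<^sup>2\<close>, which add up to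
  \<open>\<sigma>\<^sup>2 I\<^sub>N\<close>, the square of the normalising factor.\<close>

lemma (in stochastic_basis) xi_std_normal:
  assumes ind: "independent_brownian_motions w"
    and \<mu>: "\<And>k. k \<ge> 1 \<Longrightarrow> \<mu> k > 0" and q: "\<And>k. k \<ge> 1 \<Longrightarrow> q k > 0"
    and pos: "\<sigma> > 0" "T > 0" and N: "N \<ge> 1"
  shows "distributed M lborel (xi \<mu> q \<sigma> T w N) std_normal_density"
proof -
  let ?I = "fisher_information \<mu> q \<sigma> T N"
  define \<alpha> where "\<alpha> k = - (1 / (\<sigma> * sqrt ?I)) * (\<mu> k / q k)" for k
  have B: "(\<Sum>k=1..N. (\<mu> k)\<^sup>2 / (q k)\<^sup>2) > 0"
    using N \<mu> q by (intro sum_pos divide_pos_pos zero_less_power) auto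
  then have I: "?I > 0"
    using pos by (simp add: fisher_information_def)
  have \<alpha>: "\<alpha> k \<noteq> 0" if "k \<ge> 1" for k
    using that \<mu>[of k] q[of k] pos I by (auto simp: \<alpha>_def)
  \<comment> \<open>Brownian motion starts at 0 only almost surely, so \<open>w k T\<close> inherits the law of the increment
    from time 0 through a null set.\<close>
  have wT: "distributed M lborel (w k T) (normal_density 0 (sqrt T))" if "k \<ge> 1" for k
  proof -
    have bm: "brownian_motion (w k)"
      using ind that by (auto simp: independent_brownian_motions_def)
    have dist: "distributed M lborel (\<lambda>\<omega>. w k T \<omega> - w k 0 \<omega>) (normal_density 0 (sqrt (T - 0)))"
      using bm pos by (auto simp: brownian_motion_def)
    have [measurable]: "w k t \<in> borel_measurable M" if "0 \<le> t" for t
      using bm that by (auto simp: brownian_motion_def intro: borel_measurable_F_imp_M)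
    have meas: "w k T \<in> borel_measurable M" "w k 0 \<in> borel_measurable M"
      using pos by auto
    have "AE \<omega> in M. w k 0 \<omega> = 0"
      using bm by (auto simp: brownian_motion_def)
    then have "distr M lborel (w k T) = distr M lborel (\<lambda>\<omega>. w k T \<omega> - w k 0 \<omega>)"
      using meas by (intro distr_cong_AE) (auto elim: eventually_mono)
    then show ?thesis
      using dist meas by (simp add: distributed_def)
  qed
  have paths: "indep_vars (\<lambda>_. Pi\<^sub>M {0..} (\<lambda>_. borel)) (\<lambda>k \<omega>. \<lambda>t\<in>{0..}. w k t \<omega>) {1..}"
    using ind unfolding independent_brownian_motions_def by blast
  have "indep_vars (\<lambda>_. borel) (\<lambda>k \<omega>. \<alpha> k * (\<lambda>t\<in>{0..}. w k t \<omega>) T) {1..}"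
    using pos
    by (intro indep_vars_compose2[OF paths, of "\<lambda>k f. \<alpha> k * f T" "\<lambda>_. borel"]
        borel_measurable_times measurable_component_singleton borel_measurable_const) auto
  then have "indep_vars (\<lambda>_. borel) (\<lambda>k \<omega>. \<alpha> k * w k T \<omega>) {1..}"
    using pos by simp
  then have indN: "indep_vars (\<lambda>_. borel) (\<lambda>k \<omega>. \<alpha> k * w k T \<omega>) {1..N}"
    by (rule indep_vars_subset) auto
  have "distributed M lborel (\<lambda>\<omega>. \<Sum>k\<in>{1..N}. \<alpha> k * w k T \<omega>)
      (normal_density (\<Sum>k\<in>{1..N}. 0) (sqrt (\<Sum>k\<in>{1..N}. (\<bar>\<alpha> k\<bar> * sqrt T)\<^sup>2)))"
  proof (rule sum_indep_normal[OF _ _ indN])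
    fix k assume "k \<in> {1..N}"
    then have k: "k \<ge> 1" by simp
    show "0 < \<bar>\<alpha> k\<bar> * sqrt T" using \<alpha>[OF k] pos by simp
    show "distributed M lborel (\<lambda>\<omega>. \<alpha> k * w k T \<omega>) (normal_density 0 (\<bar>\<alpha> k\<bar> * sqrt T))"
      using normal_density_affine[OF wT[OF k] _ \<alpha>[OF k], of 0] pos by simp
  qed (use N in auto)
  moreover have "(\<Sum>k\<in>{1..N}. (\<bar>\<alpha> k\<bar> * sqrt T)\<^sup>2) = 1"
  proof -
    have "(\<bar>\<alpha> k\<bar> * sqrt T)\<^sup>2 = T / (\<sigma>\<^sup>2 * ?I) * ((\<mu> k)\<^sup>2 / (q k)\<^sup>2)" for k
      using pos I by (simp add: \<alpha>_def power_mult_distrib power_divide)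
    then have "(\<Sum>k\<in>{1..N}. (\<bar>\<alpha> k\<bar> * sqrt T)\<^sup>2) = T / (\<sigma>\<^sup>2 * ?I) * (\<Sum>k=1..N. (\<mu> k)\<^sup>2 / (q k)\<^sup>2)"
      by (simp add: sum_distrib_left)
    also have "\<dots> = 1"
      using B pos by (simp add: fisher_information_def)
    finally show ?thesis .
  qed
  moreover have "(\<lambda>\<omega>. \<Sum>k\<in>{1..N}. \<alpha> k * w k T \<omega>) = xi \<mu> q \<sigma> T w N"
    by (simp add: fun_eq_iff xi_def \<alpha>_def sum_distrib_left sum_negf mult_ac)
  ultimately show ?thesis by simp
qed

lemma (in stochastic_basis) theta_hat_error_eq_xi:
  assumes ind: "independent_brownian_motions w"
    and \<mu>: "\<And>k. k \<ge> 1 \<Longrightarrow> \<mu> k > 0" and q: "\<And>k. k \<ge> 1 \<Longrightarrow> q k > 0"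
    and pos: "\<sigma> > 0" "T > 0" and N: "N \<ge> 1"
    and u0: "\<And>k. k \<ge> 1 \<Longrightarrow> u0 k \<in> borel_measurable (F 0)"
      "\<And>k. k \<ge> 1 \<Longrightarrow> AE \<omega> in M. u0 k \<omega> \<noteq> 0"
  shows "AE \<omega> in M. sqrt (fisher_information \<mu> q \<sigma> T N) *
    (theta_hat M F T \<mu> q (fourier_mode \<mu> q \<sigma> u0 w \<theta>\<^sub>0) N \<omega> - \<theta>\<^sub>0) = xi \<mu> q \<sigma> T w N \<omega>"
proof -
  let ?u = "fourier_mode \<mu> q \<sigma> u0 w \<theta>\<^sub>0"
  let ?I = "fisher_information \<mu> q \<sigma> T N"
  let ?B = "\<Sum>k=1..N. (\<mu> k)\<^sup>2 / (q k)\<^sup>2"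
  have B: "?B > 0"
    using N \<mu> q by (intro sum_pos divide_pos_pos zero_less_power) auto
  then have I: "?I > 0"
    using pos by (simp add: fisher_information_def)
  have "AE \<omega> in M. \<forall>k\<in>{1..N}. ito_integral M F T (\<lambda>t \<omega>. 1 / ?u k t \<omega>) (?u k) \<omega>
      = - (\<theta>\<^sub>0 * \<mu> k) * T + \<sigma> * q k * w k T \<omega>"
  proof (rule AE_finite_allI)
    fix k assume "k \<in> {1..N}"
    then have k: "k \<ge> 1" by simp
    have bm: "brownian_motion (w k)"
      using ind k by (auto simp: independent_brownian_motions_def)
    have "?u k = (\<lambda>t \<omega>. u0 k \<omega> * exp (- (\<theta>\<^sub>0 * \<mu> k + (\<sigma> * q k)\<^sup>2 / 2) * t + \<sigma> * q k * w k t \<omega>))"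
      by (simp add: fun_eq_iff fourier_mode_def power_mult_distrib)
    then have "has_ito_integral M F T (\<lambda>t \<omega>. 1 / ?u k t \<omega>) (?u k)
        (\<lambda>\<omega>. - (\<theta>\<^sub>0 * \<mu> k) * T + \<sigma> * q k * w k T \<omega>)"
      using has_ito_integral_logarithmic_differential
        [OF bm pos(2) u0[OF k], where b = "\<sigma> * q k" and c = "\<theta>\<^sub>0 * \<mu> k"] by simp
    then show "AE \<omega> in M. ito_integral M F T (\<lambda>t \<omega>. 1 / ?u k t \<omega>) (?u k) \<omega>
        = - (\<theta>\<^sub>0 * \<mu> k) * T + \<sigma> * q k * w k T \<omega>"
      by (rule ito_integral_AE_eq[OF pos(2)])
  qed simp
  then show ?thesis
  proof eventually_elim
    case (elim \<omega>)
    define S where "S = (\<Sum>k=1..N. \<mu> k / q k * w k T \<omega>)"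
    have "(\<Sum>k=1..N. \<mu> k / (q k)\<^sup>2 * ito_integral M F T (\<lambda>t \<omega>. 1 / ?u k t \<omega>) (?u k) \<omega>)
        = (\<Sum>k=1..N. - \<theta>\<^sub>0 * T * ((\<mu> k)\<^sup>2 / (q k)\<^sup>2) + \<sigma> * (\<mu> k / q k * w k T \<omega>))"
    proof (rule sum.cong[OF refl])
      fix k assume k: "k \<in> {1..N}"
      then have "q k \<noteq> 0" using q[of k] by simp
      then show "\<mu> k / (q k)\<^sup>2 * ito_integral M F T (\<lambda>t \<omega>. 1 / ?u k t \<omega>) (?u k) \<omega>
          = - \<theta>\<^sub>0 * T * ((\<mu> k)\<^sup>2 / (q k)\<^sup>2) + \<sigma> * (\<mu> k / q k * w k T \<omega>)"
        unfolding bspec[OF elim k] by (simp add: field_simps power2_eq_square)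
    qed
    also have "\<dots> = - \<theta>\<^sub>0 * T * ?B + \<sigma> * S"
      by (simp only: sum.distrib sum_distrib_left S_def)
    finally have "theta_hat M F T \<mu> q ?u N \<omega> = - (- \<theta>\<^sub>0 * T * ?B + \<sigma> * S) / (T * ?B)"
      by (simp add: theta_hat_def)
    then have "theta_hat M F T \<mu> q ?u N \<omega> - \<theta>\<^sub>0 = - (\<sigma> * S) / (T * ?B)"
      using B pos by (simp add: field_simps)
    also have "\<dots> = - (S / (\<sigma> * ?I))"
      using B pos by (simp add: fisher_information_def field_simps power2_eq_square)
    finally have "sqrt ?I * (theta_hat M F T \<mu> q ?u N \<omega> - \<theta>\<^sub>0) = - (S / \<sigma> * (sqrt ?I / ?I))"
      by simp
    also have "sqrt ?I / ?I = 1 / sqrt ?I"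
      using I by (simp add: field_simps)
    finally show ?case
      by (simp add: xi_def S_def)
  qed
qed

theorem mainTheorem5:
  fixes M :: "'a measure" and F :: "real \<Rightarrow> 'a measure"
    and w :: "nat \<Rightarrow> real \<Rightarrow> 'a \<Rightarrow> real" and u0 :: "nat \<Rightarrow> 'a \<Rightarrow> real"
    and \<mu> q :: "nat \<Rightarrow> real" and \<sigma> T :: real
  assumes "stochastic_basis M F"
    and "stochastic_basis.independent_brownian_motions M F w"
    and "\<And>k. k \<ge> 1 \<Longrightarrow> \<mu> k > 0"
    and "filterlim \<mu> at_top sequentially"
    and "\<And>k. k \<ge> 1 \<Longrightarrow> q k > 0"
    and "\<sigma> > 0" and "T > 0"
    and "\<And>k. k \<ge> 1 \<Longrightarrow> u0 k \<in> borel_measurable (F 0)"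
    and "\<And>k. k \<ge> 1 \<Longrightarrow> AE \<omega> in M. u0 k \<omega> \<noteq> 0"
    and "\<exists>\<theta>>0. well_posed \<mu> q \<sigma> \<theta>"
  shows "\<forall>\<theta>\<^sub>0>0. let u = fourier_mode \<mu> q \<sigma> u0 w \<theta>\<^sub>0 in
      (AE \<omega> in M. (\<lambda>N. theta_hat M F T \<mu> q u N \<omega>) \<longlonglongrightarrow> \<theta>\<^sub>0) \<and>
      (AE \<omega> in M. (\<lambda>N. theta_hat_MLE M F T \<mu> q u N \<omega>) \<longlonglongrightarrow> \<theta>\<^sub>0) \<and>
      (\<forall>N\<ge>1.
         (AE \<omega> in M. sqrt (fisher_information \<mu> q \<sigma> T N) * (theta_hat M F T \<mu> q u N \<omega> - \<theta>\<^sub>0)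
            = xi \<mu> q \<sigma> T w N \<omega>) \<and>
         distributed M lborel (xi \<mu> q \<sigma> T w N) std_normal_density)"
proof (intro allI impI)
  fix \<theta>\<^sub>0 :: real assume \<theta>\<^sub>0: "\<theta>\<^sub>0 > 0"
  interpret stochastic_basis M F by fact
  let ?u = "fourier_mode \<mu> q \<sigma> u0 w \<theta>\<^sub>0"
  let ?I = "fisher_information \<mu> q \<sigma> T"
  have error: "AE \<omega> in M. sqrt (?I N) * (theta_hat M F T \<mu> q ?u N \<omega> - \<theta>\<^sub>0) = xi \<mu> q \<sigma> T w N \<omega>"
    if "N \<ge> 1" for N
    by (rule theta_hat_error_eq_xi[OF assms(2,3,5,6,7) that assms(8,9)])
  have normal: "distributed M lborel (xi \<mu> q \<sigma> T w N) std_normal_density" if "N \<ge> 1" for N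
    by (rule xi_std_normal[OF assms(2,3,5,6,7) that])
  have I_pos: "?I N > 0" if "N \<ge> 1" for N
    unfolding fisher_information_def using assms(3,5,6,7) that
    by (intro mult_pos_pos sum_pos divide_pos_pos zero_less_power) auto
  obtain \<theta> where \<theta>: "\<theta> > 0" "well_posed \<mu> q \<sigma> \<theta>"
    using assms(10) by blast
  have "summable (\<lambda>N. 1 / (?I N)\<^sup>2)"
    by (rule summable_inverse_square_fisher_information[OF assms(3-7) \<theta>])
  then have lim0: "AE \<omega> in M. (\<lambda>N. xi \<mu> q \<sigma> T w N \<omega> / sqrt (?I N)) \<longlonglongrightarrow> 0"
    by (intro std_normal_div_sqrt_tendsto_zero normal I_pos)
  have "AE \<omega> in M. \<forall>N\<in>{1..}. sqrt (?I N) * (theta_hat M F T \<mu> q ?u N \<omega> - \<theta>\<^sub>0) = xi \<mu> q \<sigma> T w N \<omega>"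
    using error by (subst AE_ball_countable) auto
  with lim0 have consistent: "AE \<omega> in M. (\<lambda>N. theta_hat M F T \<mu> q ?u N \<omega>) \<longlonglongrightarrow> \<theta>\<^sub>0"
  proof eventually_elim
    case (elim \<omega>)
    have "\<forall>\<^sub>F N in sequentially. xi \<mu> q \<sigma> T w N \<omega> / sqrt (?I N) = theta_hat M F T \<mu> q ?u N \<omega> - \<theta>\<^sub>0"
      using eventually_ge_at_top[of 1]
    proof eventually_elim
      case (elim N)
      then have "xi \<mu> q \<sigma> T w N \<omega> = sqrt (?I N) * (theta_hat M F T \<mu> q ?u N \<omega> - \<theta>\<^sub>0)"
        using \<open>\<forall>N\<in>{1..}. _ N\<close> by simp
      then show ?case using I_pos[OF elim] by simp
    qed
    from tendsto_cong[OF this] elim(1) show ?case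
      by (simp add: LIM_zero_iff)
  qed
  then have "AE \<omega> in M. (\<lambda>N. theta_hat_MLE M F T \<mu> q ?u N \<omega>) \<longlonglongrightarrow> \<theta>\<^sub>0"
  proof eventually_elim
    case (elim \<omega>)
    have "\<forall>\<^sub>F N in sequentially. theta_hat_MLE M F T \<mu> q ?u N \<omega> = theta_hat M F T \<mu> q ?u N \<omega>"
      using order_tendstoD(1)[OF elim \<theta>\<^sub>0]
      by eventually_elim (simp add: theta_hat_MLE_def)
    from tendsto_cong[OF this] elim show ?case by simp
  qed
  with consistent error normal show "let u = ?u in
      (AE \<omega> in M. (\<lambda>N. theta_hat M F T \<mu> q u N \<omega>) \<longlonglongrightarrow> \<theta>\<^sub>0) \<and>
      (AE \<omega> in M. (\<lambda>N. theta_hat_MLE M F T \<mu> q u N \<omega>) \<longlonglongrightarrow> \<theta>\<^sub>0) \<and>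
      (\<forall>N\<ge>1.
         (AE \<omega> in M. sqrt (?I N) * (theta_hat M F T \<mu> q u N \<omega> - \<theta>\<^sub>0) = xi \<mu> q \<sigma> T w N \<omega>) \<and>
         distributed M lborel (xi \<mu> q \<sigma> T w N) std_normal_density)"
    by (simp add: Let_def)
qed

end
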